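(* For every graph $G$, \[ \chi_{CF}(G)\leq D(G)+1.\] Furthermore, for every function $p=p(n)$ with $\frac12\le p(n)\leq 1$, asymptotically almost surely \[D(G(n,p(n)))-3 \leq \chi_{CF}(G(n,p(n))).\]
   Context: All graphs are finite and simple. For a vertex $x$ of a graph $G=(V,E)$, $N(x)=\{y\in V: xy\in E\}$ is its neighborhood and $N[x]=N(x)\cup\{x\}$ its closed neighborhood. A (not necessarily proper) vertex coloring of $G$ is called conflict-free if for each $x\in V$ there exists $y\in N[x]$ whose color is different from the color of each other vertex in $N[x]$. The conflict-free chromatic number $\chi_{CF}(G)$ is the smallest $r$ such that $G$ has a conflict-free coloring with $r$ colors. A set $S$ of vertices of $G$ is a dominating set if each $v\in V$ is either in $S$ or adjacent to a vertex in $S$. The domination number $D(G)$ is the smallest size of a dominating set in $G$. $G(n,p)$ denotes the Erdős–Rényi random graph on $n$ vertices, in which each pair of vertices is an edge independently with probability $p$. "Asymptotically almost surely" means with probability tending to $1$ as $n\to\infty$. *)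

theory Defs
  imports "HOL-Probability.Probability" "HOL-Probability.Product_PMF"
begin

record 'a ugraph =
  verts :: "'a set"
  edges :: "'a set set"

definition all_pairs :: "'a set \<Rightarrow> 'a set set" where
  "all_pairs V = {e. e \<subseteq> V \<and> card e = 2}"

definition finite_simple_graph :: "'a ugraph \<Rightarrow> bool" where
  "finite_simple_graph G \<longleftrightarrow> finite (verts G) \<and> edges G \<subseteq> all_pairs (verts G)"

definition nbhd :: "'a ugraph \<Rightarrow> 'a \<Rightarrow> 'a set" where
  "nbhd G x = {y \<in> verts G. {x, y} \<in> edges G}"

definition closed_nbhd :: "'a ugraph \<Rightarrow> 'a \<Rightarrow> 'a set" where
  "closed_nbhd G x = insert x (nbhd G x)"

definition conflict_free :: "'a ugraph \<Rightarrow> ('a \<Rightarrow> 'c) \<Rightarrow> bool" where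
  "conflict_free G c \<longleftrightarrow>
     (\<forall>x\<in>verts G. \<exists>y\<in>closed_nbhd G x. \<forall>z\<in>closed_nbhd G x. z \<noteq> y \<longrightarrow> c y \<noteq> c z)"

definition cf_chromatic_number :: "'a ugraph \<Rightarrow> nat" where
  "cf_chromatic_number G =
     (LEAST r. \<exists>c :: 'a \<Rightarrow> nat. c \<in> verts G \<rightarrow> {..<r} \<and> conflict_free G c)"

definition dominating_set :: "'a ugraph \<Rightarrow> 'a set \<Rightarrow> bool" where
  "dominating_set G S \<longleftrightarrow>
     S \<subseteq> verts G \<and> (\<forall>v\<in>verts G. v \<in> S \<or> (\<exists>s\<in>S. {s, v} \<in> edges G))"

definition domination_number :: "'a ugraph \<Rightarrow> nat" where
  "domination_number G = (LEAST k. \<exists>S. dominating_set G S \<and> card S = k)"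

text \<open>The vertex set is \<open>{..<n}\<close>. \<^const>\<open>Pi_pmf\<close> tosses an independent coin for every pair;
  its default value \<^term>\<open>False\<close> only concerns sets that are not pairs of vertices.\<close>

definition erdos_renyi :: "nat \<Rightarrow> real \<Rightarrow> nat ugraph pmf" where
  "erdos_renyi n p =
     map_pmf (\<lambda>present. \<lparr>verts = {..<n}, edges = {e \<in> all_pairs {..<n}. present e}\<rparr>)
       (Pi_pmf (all_pairs {..<n}) False (\<lambda>_. bernoulli_pmf p))"

text \<open>Both \<open>LEAST\<close> operators range over nonempty sets of numbers.\<close>

lemma cf_coloring_exists:
  assumes "finite_simple_graph G"
  shows "\<exists>c :: 'a \<Rightarrow> nat. c \<in> verts G \<rightarrow> {..<card (verts G)} \<and> conflict_free (G :: 'a ugraph) c"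
proof -
  obtain c :: "'a \<Rightarrow> nat" where c: "bij_betw c (verts G) {0..<card (verts G)}"
    using assms ex_bij_betw_finite_nat by (auto simp: finite_simple_graph_def)
  have "conflict_free G c"
    unfolding conflict_free_def
  proof (intro ballI)
    fix x assume "x \<in> verts G"
    moreover from this have "closed_nbhd G x \<subseteq> verts G"
      by (auto simp: closed_nbhd_def nbhd_def)
    moreover have "x \<in> closed_nbhd G x"
      by (simp add: closed_nbhd_def)
    ultimately show "\<exists>y\<in>closed_nbhd G x. \<forall>z\<in>closed_nbhd G x. z \<noteq> y \<longrightarrow> c y \<noteq> c z"
      using c by (metis bij_betw_def inj_on_def subsetD)
  qed
  moreover have "c \<in> verts G \<rightarrow> {..<card (verts G)}"
    using c by (auto simp: bij_betw_def)
  ultimately show ?thesis by blast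
qed

lemma dominating_set_verts: "dominating_set G (verts G)"
  by (simp add: dominating_set_def)

lemma erdos_renyi_finite_simple_graph:
  "G \<in> set_pmf (erdos_renyi n p) \<Longrightarrow> finite_simple_graph G"
  by (auto simp: erdos_renyi_def finite_simple_graph_def)

end

theory Submission
  imports Defs "HOL-Real_Asymp.Real_Asymp"
begin

text \<open>
  Upper bound: give the vertices of a minimum dominating set distinct colors and all other
  vertices one further color.

  Lower bound: put \<open>q = 1 - p\<close> and let \<open>k \<ge> 4\<close> be least with \<open>n q\<^sup>k \<le> (k/2) ln n\<close>, so that
  \<open>k = O(log n)\<close>. A second moment argument over transversals of \<open>k\<close> disjoint blocks of about
  \<open>n/k\<close> vertices shows that a dominating set of size \<open>k\<close> exists a.a.s. On the other hand,
  \<open>r = k - 4\<close> colors a.a.s. do not suffice. A color class matters only through a subset of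
  at most three of its vertices: if a vertex \<open>v\<close> sees a color exactly once, then it has exactly one
  neighbor in the class if that class has at most two vertices, and at most one neighbor in a
  chosen triple of the class otherwise. As \<open>p \<ge> 1/2\<close>, each of these events fails with probability
  at least \<open>q\<close>, so all \<open>v\<close> outside the chosen sets succeed with probability at most
  \<open>(1 - q\<^sup>r)\<^bsup>n-3r\<^esup>\<close>. By minimality of \<open>k\<close>, \<open>n q\<^sup>r \<ge> 8 n q\<^bsup>k-1\<^esup> > 4 (r + 3) ln n\<close>, which beats
  the at most \<open>(n + 1)\<^bsup>3r\<^esup>\<close> choices of the subsets.
\<close>

section \<open>The upper bound\<close>

lemma dominating_set_card_domination_number:
  "\<exists>S. dominating_set G S \<and> card S = domination_number G"
proof -
  have "\<exists>k S. dominating_set G S \<and> card S = k"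
    using dominating_set_verts by blast
  then show ?thesis
    unfolding domination_number_def by (rule LeastI_ex)
qed

lemma domination_number_le: "dominating_set G S \<Longrightarrow> domination_number G \<le> card S"
  unfolding domination_number_def by (rule Least_le) blast

lemma cf_chromatic_number_le:
  "c \<in> verts G \<rightarrow> {..<r} \<Longrightarrow> conflict_free G (c :: _ \<Rightarrow> nat) \<Longrightarrow> cf_chromatic_number G \<le> r"
  unfolding cf_chromatic_number_def by (rule Least_le) blast

lemma cf_chromatic_number_coloring:
  fixes G :: "'a ugraph"
  assumes "finite_simple_graph G"
  shows "\<exists>c :: 'a \<Rightarrow> nat. c \<in> verts G \<rightarrow> {..<cf_chromatic_number G} \<and> conflict_free G c"
proof -
  have "\<exists>r. \<exists>c :: 'a \<Rightarrow> nat. c \<in> verts G \<rightarrow> {..<r} \<and> conflict_free G c"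
    using cf_coloring_exists[OF assms] by blast
  then show ?thesis
    unfolding cf_chromatic_number_def by (rule LeastI_ex)
qed

lemma cf_chromatic_number_le_domination_number:
  fixes G :: "'a ugraph"
  assumes "finite_simple_graph G"
  shows "cf_chromatic_number G \<le> domination_number G + 1"
proof -
  obtain S where S: "dominating_set G S" "card S = domination_number G"
    using dominating_set_card_domination_number by blast
  let ?D = "domination_number G"
  have sub: "S \<subseteq> verts G"
    using S by (simp add: dominating_set_def)
  then have "finite S"
    using assms finite_subset by (auto simp: finite_simple_graph_def)
  then obtain b :: "'a \<Rightarrow> nat" where b: "bij_betw b S {0..<?D}"
    using ex_bij_betw_finite_nat S(2) by metis
  define c where "c v = (if v \<in> S then b v else ?D)" for v
  have less: "b v < ?D" if "v \<in> S" for v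
    using bij_betwE[OF b] that by auto
  \<comment> \<open>A vertex of \<open>S\<close> has a color shared with no other vertex, so it
    settles every closed neighborhood that contains it. Domination puts such a vertex into each of
    them.\<close>
  have uniq: "c y \<noteq> c z" if "y \<in> S" "z \<noteq> y" for y z
    using that less[of y] inj_onD[OF bij_betw_imp_inj_on[OF b], of y z] by (auto simp: c_def)
  have "conflict_free G c"
    unfolding conflict_free_def
  proof
    fix x assume x: "x \<in> verts G"
    have "\<exists>y\<in>closed_nbhd G x. y \<in> S"
    proof (cases "x \<in> S")
      case False
      then obtain s where "s \<in> S" "{s, x} \<in> edges G"
        using S(1) x by (auto simp: dominating_set_def)
      then show ?thesis
        using sub by (intro bexI[of _ s]) (auto simp: closed_nbhd_def nbhd_def insert_commute)
    qed (auto simp: closed_nbhd_def)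
    then show "\<exists>y\<in>closed_nbhd G x. \<forall>z\<in>closed_nbhd G x. z \<noteq> y \<longrightarrow> c y \<noteq> c z"
      using uniq by blast
  qed
  moreover have "c \<in> verts G \<rightarrow> {..<?D + 1}"
    using less by (auto simp: c_def less_Suc_eq)
  ultimately show ?thesis
    by (intro cf_chromatic_number_le)
qed

section \<open>Independence in products of coins\<close>

text \<open>Cutting \<open>A\<close> and \<open>B\<close> down to the supports changes no
  probability and makes both sets countable, where the product rule for point masses
  applies.\<close>

lemma prob_pair_pmf_Times:
  "measure_pmf.prob (pair_pmf M N) (A \<times> B) = measure_pmf.prob M A * measure_pmf.prob N B"
proof -
  have "measure_pmf.prob (pair_pmf M N) (A \<times> B) =
      measure_pmf.prob (pair_pmf M N) ((A \<inter> set_pmf M) \<times> (B \<inter> set_pmf N))"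
    by (intro measure_pmf.finite_measure_eq_AE) (auto simp: AE_measure_pmf_iff)
  also have "\<dots> = measure_pmf.prob M (A \<inter> set_pmf M) * measure_pmf.prob N (B \<inter> set_pmf N)"
    by (rule measure_pmf_prob_product) auto
  finally show ?thesis
    by (simp add: measure_Int_set_pmf)
qed

text \<open>Splitting the coordinates into \<open>J\<close> and \<open>I - J\<close> turns the
  product into a pair of independent parts. The congruence hypotheses say that \<open>P\<close>
  reads only the first part and \<open>Q\<close> only the second.\<close>

lemma prob_Pi_pmf_Int:
  assumes "finite I" "J \<subseteq> I"
    and P: "\<And>f g. (\<And>e. e \<in> J \<Longrightarrow> f e = g e) \<Longrightarrow> P f \<longleftrightarrow> P g"
    and Q: "\<And>f g. (\<And>e. e \<in> I - J \<Longrightarrow> f e = g e) \<Longrightarrow> Q f \<longleftrightarrow> Q g"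
  shows "measure_pmf.prob (Pi_pmf I d q) {f. P f \<and> Q f} =
         measure_pmf.prob (Pi_pmf I d q) {f. P f} * measure_pmf.prob (Pi_pmf I d q) {f. Q f}"
proof -
  let ?J = "Pi_pmf J d q" and ?K = "Pi_pmf (I - J) d q"
  have fin: "finite J" "finite (I - J)"
    using assms finite_subset by auto
  have "I = J \<union> (I - J)"
    using assms by auto
  then have I: "Pi_pmf I d q = map_pmf (\<lambda>(f, g) x. if x \<in> J then f x else g x) (pair_pmf ?J ?K)"
    using Pi_pmf_union[OF fin, of d q] by simp
  have PJ: "P (\<lambda>x. if x \<in> J then f x else g x) = P f" for f g
    by (rule P) simp
  have QK: "Q (\<lambda>x. if x \<in> J then f x else g x) = Q g" for f g
    by (rule Q) simp
  \<comment> \<open>Stated for arbitrary \<open>P'\<close> and \<open>Q'\<close> so that replacing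
    one of them by a trivially true event also yields the two marginal probabilities.\<close>
  have "measure_pmf.prob (Pi_pmf I d q) {f. P' f \<and> Q' f} =
        measure_pmf.prob ?J {f. P' f} * measure_pmf.prob ?K {f. Q' f}"
    if "\<And>f g. P' (\<lambda>x. if x \<in> J then f x else g x) = P' f"
       "\<And>f g. Q' (\<lambda>x. if x \<in> J then f x else g x) = Q' g" for P' Q'
  proof -
    have "(\<lambda>(f, g) x. if x \<in> J then f x else g x) -` {f. P' f \<and> Q' f} = {f. P' f} \<times> {f. Q' f}"
      using that by auto
    then show ?thesis
      unfolding I measure_map_pmf by (simp add: prob_pair_pmf_Times)
  qed
  note prod = this
  show ?thesis
    using prod[of P Q, OF PJ QK] prod[of P "\<lambda>_. True", OF PJ refl]
      prod[of "\<lambda>_. True" Q, OF refl QK] by simp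
qed

lemma prob_Pi_pmf_INT:
  assumes "finite I" "finite V"
    and "\<And>v. v \<in> V \<Longrightarrow> B v \<subseteq> I" "disjoint_family_on B V"
    and "\<And>v f g. v \<in> V \<Longrightarrow> (\<And>e. e \<in> B v \<Longrightarrow> f e = g e) \<Longrightarrow> P v f \<longleftrightarrow> P v g"
  shows "measure_pmf.prob (Pi_pmf I d q) {f. \<forall>v\<in>V. P v f} =
         (\<Prod>v\<in>V. measure_pmf.prob (Pi_pmf I d q) {f. P v f})"
  using assms(2-)
proof (induction V rule: finite_induct)
  case (insert w V)
  have disj: "B v \<inter> B w = {}" if "v \<in> V" for v
    using insert.prems(2) insert.hyps that by (auto simp: disjoint_family_on_def)
  have "measure_pmf.prob (Pi_pmf I d q) {f. P w f \<and> (\<forall>v\<in>V. P v f)} =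
        measure_pmf.prob (Pi_pmf I d q) {f. P w f} *
        measure_pmf.prob (Pi_pmf I d q) {f. \<forall>v\<in>V. P v f}"
  proof (rule prob_Pi_pmf_Int[where J = "B w"])
    show "P w f = P w g" if "\<And>e. e \<in> B w \<Longrightarrow> f e = g e" for f g
      by (rule insert.prems(3)) (use that in auto)
    show "(\<forall>v\<in>V. P v f) = (\<forall>v\<in>V. P v g)" if "\<And>e. e \<in> I - B w \<Longrightarrow> f e = g e" for f g
    proof (intro ball_cong refl)
      fix v assume "v \<in> V"
      then show "P v f = P v g"
        using insert.prems(1)[of v] disj[of v] by (intro insert.prems(3) that) auto
    qed
  qed (use assms(1) insert.prems(1) in auto)
  also have "measure_pmf.prob (Pi_pmf I d q) {f. \<forall>v\<in>V. P v f} =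
      (\<Prod>v\<in>V. measure_pmf.prob (Pi_pmf I d q) {f. P v f})"
  proof (rule insert.IH)
    show "disjoint_family_on B V"
      using insert.prems(2) by (auto simp: disjoint_family_on_def)
  qed (use insert.prems(1,3) in blast)+
  finally show ?case
    using insert.hyps by simp
qed simp

lemma prob_card_Pi_bernoulli:
  assumes "finite I" "B \<subseteq> I" "p \<in> {0..1}"
  shows "measure_pmf.prob (Pi_pmf I d (\<lambda>_. bernoulli_pmf p)) {f. R (card {e \<in> B. f e})} =
         measure_pmf.prob (binomial_pmf (card B) p) {t. R t}"
proof -
  have "binomial_pmf (card B) p =
      map_pmf (\<lambda>f. card {e \<in> B. f e}) (Pi_pmf B d (\<lambda>_. bernoulli_pmf p))"
    using assms finite_subset by (intro binomial_pmf_altdef') auto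
  also have "\<dots> = map_pmf (\<lambda>f. card {e \<in> B. f e}) (Pi_pmf I d (\<lambda>_. bernoulli_pmf p))"
    unfolding Pi_pmf_subset[OF assms(1,2)] map_pmf_comp
    by (intro map_pmf_cong refl arg_cong[where f = card]) auto
  finally show ?thesis
    by (simp add: vimage_def)
qed

text \<open>For \<open>v\<close> outside \<open>A\<close> these are the coins deciding which
  vertices of \<open>A\<close> are neighbors of \<open>v\<close>. Independence of adjacency events
  becomes disjointness of stars.\<close>

definition star :: "'a \<Rightarrow> 'a set \<Rightarrow> 'a set set" where
  "star v A = (\<lambda>a. {v, a}) ` A"

abbreviation coins :: "nat \<Rightarrow> real \<Rightarrow> (nat set \<Rightarrow> bool) pmf" where
  "coins n p \<equiv> Pi_pmf (all_pairs {..<n}) False (\<lambda>_. bernoulli_pmf p)"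

lemma finite_all_pairs: "finite V \<Longrightarrow> finite (all_pairs V)"
  by (rule finite_subset[of _ "Pow V"]) (auto simp: all_pairs_def)

lemma star_subset: "v \<in> V \<Longrightarrow> A \<subseteq> V \<Longrightarrow> v \<notin> A \<Longrightarrow> star v A \<subseteq> all_pairs V"
  unfolding star_def all_pairs_def by (auto simp: card_insert_if)

text \<open>In a common pair \<open>{v, a} = {w, b}\<close> with \<open>b\<close> in
  \<open>A\<close>, the element \<open>v\<close> differs from \<open>w\<close>, so it would be
  \<open>b\<close> and lie in \<open>A\<close>.\<close>

lemma star_disjoint:
  assumes "v \<noteq> w" "v \<notin> A"
  shows "star v A \<inter> star w A = {}"
proof -
  have "{v, a} \<noteq> {w, b}" if "b \<in> A" for a b
    using assms that by (metis insert_iff singletonD)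
  then show ?thesis
    unfolding star_def by blast
qed

lemma doubleton_left: "{v, a} = {v, b} \<longleftrightarrow> a = b"
  by (metis doubleton_eq_iff)

lemma star_disjoint': "A \<inter> B = {} \<Longrightarrow> star v A \<inter> star v B = {}"
  by (auto simp: star_def doubleton_left)

lemma card_star: "card (star v A) = card A"
  unfolding star_def by (rule card_image) (simp add: inj_on_def doubleton_left)

lemma card_star_filter: "card {e \<in> star v A. f e} = card {a \<in> A. f {v, a}}"
proof -
  have "{e \<in> star v A. f e} = star v {a \<in> A. f {v, a}}"
    by (auto simp: star_def)
  then show ?thesis
    by (simp add: card_star)
qed

section \<open>Adjacency of vertices to fixed sets\<close>

lemma prob_card_neighbours:
  assumes "v < n" "A \<subseteq> {..<n}" "v \<notin> A" "p \<in> {0..1}"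
  shows "measure_pmf.prob (coins n p) {f. R (card {a \<in> A. f {v, a}})} =
         measure_pmf.prob (binomial_pmf (card A) p) {t. R t}"
  using prob_card_Pi_bernoulli[OF finite_all_pairs star_subset[of v "{..<n}" A], where R = R] assms
  by (simp add: card_star card_star_filter)

lemma prob_no_neighbour:
  assumes "v < n" "A \<subseteq> {..<n}" "v \<notin> A" "p \<in> {0..1}"
  shows "measure_pmf.prob (coins n p) {f. \<forall>a\<in>A. \<not> f {v, a}} = (1 - p) ^ card A"
proof -
  have "finite A"
    using assms finite_subset by auto
  then have "(\<forall>a\<in>A. \<not> f {v, a}) \<longleftrightarrow> card {a \<in> A. f {v, a}} = 0" for f
    by auto
  then show ?thesis
    using prob_card_neighbours[OF assms, of "\<lambda>t. t = 0"] assms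
    by (simp add: measure_pmf_single)
qed

text \<open>Vertices of \<open>V\<close> have disjoint stars to \<open>A \<union> B\<close>, so the
  probability is a product over \<open>V\<close>. Each factor is inclusion-exclusion for having no
  neighbor in \<open>A\<close> or none in \<open>B\<close>. Taking \<open>A = B\<close> covers a
  single dominating set.\<close>

lemma prob_all_dominated:
  assumes "A \<subseteq> {..<n}" "B \<subseteq> {..<n}" "V \<subseteq> {..<n}" "V \<inter> (A \<union> B) = {}" "p \<in> {0..1}"
  shows "measure_pmf.prob (coins n p)
           {f. \<forall>v\<in>V. (\<exists>a\<in>A. f {v, a}) \<and> (\<exists>b\<in>B. f {v, b})} =
         (1 - (1 - p) ^ card A - (1 - p) ^ card B + (1 - p) ^ card (A \<union> B)) ^ card V"
proof -
  let ?P = "measure_pmf.prob (coins n p)"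
  have "?P {f. \<forall>v\<in>V. (\<exists>a\<in>A. f {v, a}) \<and> (\<exists>b\<in>B. f {v, b})} =
      (\<Prod>v\<in>V. ?P {f. (\<exists>a\<in>A. f {v, a}) \<and> (\<exists>b\<in>B. f {v, b})})"
  proof (rule prob_Pi_pmf_INT[where B = "\<lambda>v. star v (A \<union> B)"])
    show "disjoint_family_on (\<lambda>v. star v (A \<union> B)) V"
      unfolding disjoint_family_on_def using assms by (intro ballI impI star_disjoint) auto
    show "star v (A \<union> B) \<subseteq> all_pairs {..<n}" if "v \<in> V" for v
      using assms that by (intro star_subset) auto
    show "((\<exists>a\<in>A. f {v, a}) \<and> (\<exists>b\<in>B. f {v, b})) = ((\<exists>a\<in>A. g {v, a}) \<and> (\<exists>b\<in>B. g {v, b}))"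
      if "\<And>e. e \<in> star v (A \<union> B) \<Longrightarrow> f e = g e" for v f g
      using that by (auto simp: star_def)
    show "finite V"
      using assms(3) by (rule finite_subset) simp
  qed (simp_all add: finite_all_pairs)
  also have "\<dots> = (\<Prod>v\<in>V. 1 - (1 - p) ^ card A - (1 - p) ^ card B + (1 - p) ^ card (A \<union> B))"
  proof (rule prod.cong[OF refl])
    fix v assume "v \<in> V"
    then have v: "v < n" "v \<notin> A" "v \<notin> B"
      using assms by auto
    let ?N = "\<lambda>A. {f. \<forall>a\<in>A. \<not> f {v, a}}"
    have "{f. (\<exists>a\<in>A. f {v, a}) \<and> (\<exists>b\<in>B. f {v, b})} = UNIV - (?N A \<union> ?N B)"
      by auto
    then have "?P {f. (\<exists>a\<in>A. f {v, a}) \<and> (\<exists>b\<in>B. f {v, b})} = 1 - ?P (?N A \<union> ?N B)"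
      using measure_pmf.prob_compl[of "?N A \<union> ?N B" "coins n p"] by simp
    also have "?P (?N A \<union> ?N B) = ?P (?N A) + ?P (?N B) - ?P (?N A \<inter> ?N B)"
      by (rule measure_Un3) (simp_all add: measure_pmf.fmeasurable_eq_sets)
    also have "?N A \<inter> ?N B = ?N (A \<union> B)"
      by auto
    finally show "?P {f. (\<exists>a\<in>A. f {v, a}) \<and> (\<exists>b\<in>B. f {v, b})} =
        1 - (1 - p) ^ card A - (1 - p) ^ card B + (1 - p) ^ card (A \<union> B)"
      using v assms by (simp add: prob_no_neighbour)
  qed
  finally show ?thesis
    by simp
qed

section \<open>Small dominating sets in random graphs\<close>

text \<open>Chebyshev's argument for the number \<open>X\<close> of events that occur, with mean
  \<open>\<mu>\<close>: where none occurs, \<open>(X - \<mu>)^2\<close> equals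
  \<open>\<mu>^2\<close>, so \<open>\<mu>^2\<close> times this probability is at most the variance,
  which \<open>pairs\<close> bounds by \<open>\<delta> * \<mu>^2\<close>.\<close>

lemma prob_none_le_second_moment:
  fixes M :: "'a pmf" and E :: "'h \<Rightarrow> 'a set" and a \<delta> :: real
  assumes "finite F" "F \<noteq> {}" "a > 0"
    and E: "\<And>h. h \<in> F \<Longrightarrow> measure_pmf.prob M (E h) = a"
    and pairs: "(\<Sum>h\<in>F. \<Sum>g\<in>F. measure_pmf.prob M (E h \<inter> E g)) \<le> (1 + \<delta>) * (card F * a)\<^sup>2"
  shows "measure_pmf.prob M {x. \<forall>h\<in>F. x \<notin> E h} \<le> \<delta>"
proof -
  define X :: "'a \<Rightarrow> real" where "X x = (\<Sum>h\<in>F. indicator (E h) x)" for x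
  define Z where "Z = {x. \<forall>h\<in>F. x \<notin> E h}"
  define \<mu> where "\<mu> = card F * a"
  have "\<mu> > 0"
    using assms by (simp add: \<mu>_def card_gt_0_iff)
  have int [simp]: "integrable (measure_pmf M) (indicator A :: 'a \<Rightarrow> real)" for A
    by (rule measure_pmf.integrable_const_bound[where B = 1]) auto
  have X2: "(X x)\<^sup>2 = (\<Sum>h\<in>F. \<Sum>g\<in>F. indicator (E h \<inter> E g) x)" for x
    by (simp add: X_def power2_eq_square sum_product indicator_inter_arith)
  have intX: "integrable (measure_pmf M) X"
    unfolding X_def[abs_def] by simp
  have intX2: "integrable (measure_pmf M) (\<lambda>x. (X x)\<^sup>2)"
    unfolding X2 by simp
  have EX: "measure_pmf.expectation M X = \<mu>"
    unfolding X_def[abs_def] using E by (simp add: \<mu>_def)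
  have EX2: "measure_pmf.expectation M (\<lambda>x. (X x)\<^sup>2) \<le> (1 + \<delta>) * \<mu>\<^sup>2"
    unfolding X2 using pairs by (simp add: \<mu>_def)
  have "\<mu>\<^sup>2 * measure_pmf.prob M Z = measure_pmf.expectation M (\<lambda>x. \<mu>\<^sup>2 * indicat_real Z x)"
    by simp
  also have "\<dots> \<le> measure_pmf.expectation M (\<lambda>x. (X x)\<^sup>2 - 2 * \<mu> * X x + \<mu>\<^sup>2)"
  proof (rule integral_mono)
    fix x
    have "X x = 0" if "x \<in> Z"
      using that by (simp add: X_def Z_def)
    moreover have "0 \<le> (X x - \<mu>)\<^sup>2"
      by simp
    ultimately show "\<mu>\<^sup>2 * indicator Z x \<le> (X x)\<^sup>2 - 2 * \<mu> * X x + \<mu>\<^sup>2"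
      by (auto simp: indicator_def power2_eq_square algebra_simps)
  qed (use intX intX2 in auto)
  also have "\<dots> = measure_pmf.expectation M (\<lambda>x. (X x)\<^sup>2) - 2 * \<mu> * \<mu> + \<mu>\<^sup>2"
    using intX intX2 EX by simp
  also have "\<dots> \<le> \<mu>\<^sup>2 * \<delta>"
    using EX2 by (simp add: power2_eq_square algebra_simps)
  finally show ?thesis
    using \<open>\<mu> > 0\<close> unfolding Z_def by simp
qed

text \<open>Used to replace the factor \<open>k\<close> of the threshold by the overlap
  \<open>j\<close> of two candidate sets. With \<open>i = k - j\<close> it follows from
  \<open>j + i \<le> j * (1 + i) \<le> j * 2 ^ i\<close>.\<close>

lemma mult_half_power_le:
  fixes j k :: nat
  assumes "1 \<le> j" "j \<le> k"
  shows "k * (1 / 2 :: real) ^ (k - j) \<le> j"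
proof -
  obtain i where k: "k = j + i"
    using assms le_Suc_ex by blast
  have "j + i \<le> j * (1 + i)"
    using assms by (simp add: algebra_simps)
  also have "\<dots> \<le> j * 2 ^ i"
  proof (rule mult_le_mono2)
    show "1 + i \<le> 2 ^ i"
      by (induction i) auto
  qed
  finally have "real (j + i) \<le> j * 2 ^ i"
    by (metis of_nat_le_iff of_nat_mult of_nat_numeral of_nat_power)
  then show ?thesis
    by (simp add: k field_simps power_divide)
qed

text \<open>The left side is the chance that two \<open>k\<close>-sets sharing \<open>j\<close>
  vertices both dominate everything outside their union. Its base exceeds \<open>(1 - Q)^2\<close>
  by at most \<open>y\<close>, and \<open>n * y \<le> j / 2 * ln n\<close>, so each shared vertex
  costs a factor \<open>n powr (3/5)\<close>. An exponent below 1 is essential: agreeing in one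
  block has probability only about \<open>k / n\<close>.\<close>

lemma pair_domination_bound:
  fixes q Q :: real and n k j :: nat
  assumes Q_def: "Q = q ^ k"
    and q: "0 \<le> q" "q \<le> 1 / 2" and k: "4 \<le> k" "2 * k \<le> n" and j: "j \<le> k"
    and Q: "n * Q \<le> k / 2 * ln n" "2 * k * Q < 1"
  shows "(1 - Q - Q + q ^ (2 * k - j)) ^ (n - (2 * k - j)) \<le>
         ((1 - Q) ^ (n - k))\<^sup>2 * (n powr (3/5)) ^ j / (1 - 2 * k * Q)"
proof -
  define b where "b = 1 - Q - Q + q ^ (2 * k - j)"
  define D where "D = (1 - Q)\<^sup>2"
  \<comment> \<open>For \<open>j = 0\<close> the two events are uncorrelated outside both sets, so nothing is lost there.\<close>
  define y where "y = (if j = 0 then 0 else Q * q ^ (k - j))"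
  have n: "n > 0" "ln n \<ge> 0"
    using k by auto
  have "Q \<le> (1 / 2) ^ k"
    unfolding Q_def using q by (intro power_mono) auto
  also have "(1 / 2 :: real) ^ k \<le> (1 / 2) ^ 4"
    using k by (intro power_decreasing) auto
  finally have Q16: "0 \<le> Q" "Q \<le> 1 / 16"
    using q by (auto simp: Q_def power_divide)
  \<comment> \<open>\<open>D \<ge> 5/6\<close> lets the additive excess \<open>y\<close> become a
    factor \<open>1 + 6/5 * y\<close>; the exponent 3/5 is this 6/5 times the 1/2 in the
    threshold.\<close>
  have "(15 / 16)\<^sup>2 \<le> D"
    unfolding D_def using Q16 by (intro power_mono) auto
  then have D: "5 / 6 \<le> D" "D > 0"
    by (auto simp: power2_eq_square)
  have "2 * k - j = k + (k - j)"
    using j by simp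
  then have q2: "q ^ (2 * k - j) = Q * q ^ (k - j)"
    by (simp add: Q_def power_add)
  have "q ^ (k - j) \<le> 1"
    using q by (intro power_le_one) auto
  then have b1: "b \<le> 1"
    using Q16 mult_left_le[of "q ^ (k - j)" Q] by (simp add: b_def q2)
  have "q ^ (k - j) \<ge> 0"
    using q by simp
  then have b0: "0 \<le> b" and y0: "0 \<le> y"
    using Q16 mult_nonneg_nonneg[of Q "q ^ (k - j)"] by (auto simp: b_def q2 y_def)
  have "b = D + (Q * q ^ (k - j) - Q * Q)"
    unfolding b_def q2 D_def by (simp add: power2_eq_square algebra_simps)
  also have "\<dots> \<le> D + y"
    using Q16 by (auto simp: y_def Q_def[symmetric])
  also have "\<dots> \<le> D * (1 + 6 / 5 * y)"
    using D mult_right_mono[OF D(1) y0] by (simp add: algebra_simps)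
  also have "\<dots> \<le> D * exp (6 / 5 * y)"
    using D exp_ge_add_one_self[of "6 / 5 * y"] by (intro mult_left_mono) auto
  finally have b: "b \<le> D * exp (6 / 5 * y)" .
  have ny: "n * y \<le> j / 2 * ln n"
  proof (cases "j = 0")
    case False
    have "n * y = (n * Q) * q ^ (k - j)"
      using False by (simp add: y_def)
    also have "\<dots> \<le> (k / 2 * ln n) * (1 / 2) ^ (k - j)"
      using q n by (intro mult_mono[OF Q(1) power_mono]) auto
    also have "\<dots> = (k * (1 / 2) ^ (k - j)) * (ln n / 2)"
      by simp
    also have "\<dots> \<le> j * (ln n / 2)"
      using False j n by (intro mult_right_mono mult_half_power_le) auto
    finally show ?thesis
      by simp
  qed (simp add: y_def)
  have "(n - 2 * k) * (6 / 5 * y) \<le> n * (6 / 5 * y)"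
    using y0 by (intro mult_right_mono) auto
  then have "(n - 2 * k) * (6 / 5 * y) \<le> j * (3 / 5 * ln n)"
    using ny by simp
  then have "exp ((n - 2 * k) * (6 / 5 * y)) \<le> exp (j * (3 / 5 * ln n))"
    by simp
  also have "\<dots> = (n powr (3/5)) ^ j"
    using n by (simp only: exp_of_nat_mult powr_def) simp
  finally have e: "exp (6 / 5 * y) ^ (n - 2 * k) \<le> (n powr (3/5)) ^ j"
    by (simp only: exp_of_nat_mult)
  \<comment> \<open>\<open>D ^ (n - 2 * k)\<close> lacks \<open>2 * k\<close> factors
    \<open>1 - Q\<close> compared with the squared single probability. Bernoulli's inequality bounds
    the price of inserting them.\<close>
  have L: "1 - 2 * k * Q \<le> (1 - Q) ^ (2 * k)"
    using Bernoulli_inequality[of "- Q" "2 * k"] Q16 by simp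
  have "b ^ (n - (2 * k - j)) \<le> b ^ (n - 2 * k)"
    using b0 b1 by (intro power_decreasing) auto
  also have "\<dots> \<le> (D * exp (6 / 5 * y)) ^ (n - 2 * k)"
    using b b0 by (intro power_mono)
  also have "\<dots> \<le> D ^ (n - 2 * k) * (n powr (3/5)) ^ j"
    unfolding power_mult_distrib using e D by (intro mult_left_mono) auto
  also have "\<dots> \<le> ((1 - Q) ^ (n - k))\<^sup>2 / (1 - 2 * k * Q) * (n powr (3/5)) ^ j"
  proof (rule mult_right_mono)
    have "D ^ (n - 2 * k) * (1 - 2 * k * Q) \<le> D ^ (n - 2 * k) * (1 - Q) ^ (2 * k)"
      using L D by (intro mult_left_mono) auto
    also have "\<dots> = (1 - Q) ^ (2 * (n - 2 * k) + 2 * k)"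
      by (simp only: D_def power_mult power_add)
    also have "2 * (n - 2 * k) + 2 * k = (n - k) * 2"
      using k by simp
    finally have "D ^ (n - 2 * k) * (1 - 2 * k * Q) \<le> ((1 - Q) ^ (n - k))\<^sup>2"
      by (simp only: power_mult)
    then show "D ^ (n - 2 * k) \<le> ((1 - Q) ^ (n - k))\<^sup>2 / (1 - 2 * k * Q)"
      using Q(2) by (subst pos_le_divide_eq) auto
  qed simp
  finally show ?thesis
    unfolding b_def by simp
qed

section \<open>Overlaps of transversals of disjoint blocks\<close>

lemma sum_power_agreements:
  fixes T :: real
  assumes "\<And>i. i < k \<Longrightarrow> h i < m"
  shows "(\<Sum>g\<in>PiE {..<k} (\<lambda>_. {..<m}). T ^ card {i \<in> {..<k}. h i = g i}) = (real m - 1 + T) ^ k"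
proof -
  \<comment> \<open>The power is a product over coordinates, so the sum over \<open>g\<close>
    factorizes. In each coordinate one value agrees with \<open>h\<close> and contributes
    \<open>T\<close>, the other \<open>m - 1\<close> contribute 1.\<close>
  have "(\<Sum>g\<in>PiE {..<k} (\<lambda>_. {..<m}). T ^ card {i \<in> {..<k}. h i = g i}) =
      (\<Sum>g\<in>PiE {..<k} (\<lambda>_. {..<m}). \<Prod>i<k. if h i = g i then T else 1)"
    by (simp flip: prod.inter_filter)
  also have "\<dots> = (\<Prod>i<k. \<Sum>a<m. if h i = a then T else 1)"
    by (rule prod_sum_PiE[symmetric]) auto
  also have "\<dots> = (\<Prod>i<k. real m - 1 + T)"
  proof (rule prod.cong[OF refl])
    fix i assume "i \<in> {..<k}"
    then have "h i < m"
      using assms by simp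
    then show "(\<Sum>a<m. if h i = a then T else 1) = real m - 1 + T"
      by (subst sum.remove[of _ "h i"]) (auto simp: of_nat_diff)
  qed
  finally show ?thesis
    by simp
qed

text \<open>One vertex from each block of \<open>m\<close> consecutive numbers, at offset
  \<open>h i\<close> in block \<open>i\<close>. Compared with arbitrary \<open>k\<close>-sets, the
  overlap of two transversals is counted coordinate by coordinate, which makes the second moment an
  exact power.\<close>

definition transversal :: "nat \<Rightarrow> nat \<Rightarrow> (nat \<Rightarrow> nat) \<Rightarrow> nat set" where
  "transversal m k h = (\<lambda>i. i * m + h i) ` {..<k}"

lemma block_index_eq:
  fixes m :: nat
  assumes "a < m" "b < m"
  shows "i * m + a = j * m + b \<longleftrightarrow> i = j \<and> a = b"
proof
  assume eq: "i * m + a = j * m + b"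
  have "(i * m + a) div m = i" "(j * m + b) div m = j"
    using assms by auto
  with eq have "i = j"
    by simp
  with eq show "i = j \<and> a = b"
    by simp
qed simp

lemma transversal_subset:
  assumes "\<And>i. i < k \<Longrightarrow> h i < m" "k * m \<le> n"
  shows "transversal m k h \<subseteq> {..<n}"
proof -
  have "i * m + h i < n" if "i < k" for i
  proof -
    have "i * m + h i < (i + 1) * m"
      using assms that by simp
    also have "\<dots> \<le> k * m"
      using that by (intro mult_le_mono1) simp
    finally show ?thesis
      using assms by simp
  qed
  then show ?thesis
    by (auto simp: transversal_def)
qed

lemma card_transversal:
  assumes "\<And>i. i < k \<Longrightarrow> h i < m"
  shows "card (transversal m k h) = k"
proof -
  have "inj_on (\<lambda>i. i * m + h i) {..<k}"
    using assms by (auto simp: inj_on_def block_index_eq)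
  then show ?thesis
    by (simp add: transversal_def card_image)
qed

lemma card_transversal_Un:
  assumes h: "\<And>i. i < k \<Longrightarrow> h i < m" and g: "\<And>i. i < k \<Longrightarrow> g i < m"
  shows "card (transversal m k h \<union> transversal m k g) = 2 * k - card {i \<in> {..<k}. h i = g i}"
proof -
  have "transversal m k h \<inter> transversal m k g = (\<lambda>i. i * m + h i) ` {i \<in> {..<k}. h i = g i}"
    using assms by (auto simp: transversal_def block_index_eq image_iff)
  moreover have "inj_on (\<lambda>i. i * m + h i) {i \<in> {..<k}. h i = g i}"
    using assms by (auto simp: inj_on_def block_index_eq)
  ultimately have "card (transversal m k h \<inter> transversal m k g) = card {i \<in> {..<k}. h i = g i}"
    by (simp only: card_image)
  moreover have "finite (transversal m k h)" "finite (transversal m k g)"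
    by (simp_all add: transversal_def)
  ultimately show ?thesis
    using card_Un_Int[of "transversal m k h" "transversal m k g"]
    by (simp add: card_transversal[OF h] card_transversal[OF g])
qed

text \<open>Second moment over all transversals. Summing the pair bound gives
  \<open>(m - 1 + T) ^ k\<close> in place of \<open>m ^ k\<close>, and
  \<open>m - 1 + T \<le> m * exp (T / m)\<close>. For \<open>k\<close> logarithmic in
  \<open>n\<close> the exponent \<open>k * T / m\<close> tends to 0, and so does the whole
  bound.\<close>

lemma prob_not_dominated_le:
  fixes p :: real and n k :: nat
  assumes p: "1 / 2 \<le> p" "p \<le> 1" and k: "4 \<le> k" "2 * k \<le> n"
    and Q: "n * (1 - p) ^ k \<le> k / 2 * ln n" "2 * k * (1 - p) ^ k < 1"
  shows "measure_pmf.prob (coins n p)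
      {f. \<not> (\<exists>A\<subseteq>{..<n}. card A = k \<and> (\<forall>v\<in>{..<n} - A. \<exists>a\<in>A. f {v, a}))}
    \<le> exp (k * n powr (3/5) / (n div k)) / (1 - 2 * k * (1 - p) ^ k) - 1"
proof -
  let ?P = "measure_pmf.prob (coins n p)"
  define m where "m = n div k"
  define q where "q = 1 - p"
  define Q where "Q = q ^ k"
  define a where "a = (1 - Q) ^ (n - k)"
  define F where "F = PiE {..<k} (\<lambda>_. {..<m})"
  define E where "E h = {f. \<forall>v\<in>{..<n} - transversal m k h. \<exists>a\<in>transversal m k h. f {v, a}}" for h
  define T where "T = n powr (3/5)"
  define L where "L = 1 - 2 * k * Q"
  have m: "m > 0" "k * m \<le> n"
    using k by (auto simp: m_def div_greater_zero_iff)
  have L: "L > 0"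
    using Q by (simp add: L_def Q_def q_def)
  have q: "0 \<le> q" "q \<le> 1 / 2"
    using p by (auto simp: q_def)
  have "2 * k * Q \<ge> 1 * Q"
    using k q by (intro mult_right_mono) (auto simp: Q_def)
  then have "Q < 1"
    using L by (simp add: L_def)
  then have a: "a > 0"
    by (simp add: a_def)
  have F: "finite F" "F \<noteq> {}" "card F = m ^ k"
    using m by (auto simp: F_def finite_PiE PiE_eq_empty_iff card_PiE)
  have hm: "h i < m" if "h \<in> F" "i < k" for h i
    using that by (auto simp: F_def PiE_iff)
  have sub: "transversal m k h \<subseteq> {..<n}" and card: "card (transversal m k h) = k" if "h \<in> F" for h
    using hm[OF that] m(2) by (simp_all add: transversal_subset card_transversal)
  have single: "?P (E h) = a" if h: "h \<in> F" for h
  proof -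
    let ?A = "transversal m k h"
    have "?P (E h) = (1 - q ^ card ?A - q ^ card ?A + q ^ card (?A \<union> ?A)) ^ card ({..<n} - ?A)"
      using prob_all_dominated[of ?A n ?A "{..<n} - ?A" p] sub[OF h] p
      by (auto simp: E_def q_def)
    also have "\<dots> = a"
      using sub[OF h] finite_subset[OF sub[OF h]]
      by (simp add: card[OF h] card_Diff_subset a_def Q_def)
    finally show ?thesis .
  qed
  have pair: "?P (E h \<inter> E g) \<le> a\<^sup>2 / L * T ^ card {i \<in> {..<k}. h i = g i}"
    if h: "h \<in> F" and g: "g \<in> F" for h g
  proof -
    let ?A = "transversal m k h" and ?B = "transversal m k g"
    define j where "j = card {i \<in> {..<k}. h i = g i}"
    have "j \<le> card {..<k}"
      unfolding j_def by (rule card_mono) auto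
    then have j: "j \<le> k"
      by simp
    have AB: "card (?A \<union> ?B) = 2 * k - j"
      unfolding j_def by (rule card_transversal_Un) (use h g hm in auto)
    have fin: "finite (?A \<union> ?B)"
      using finite_subset[OF sub[OF h]] finite_subset[OF sub[OF g]] by simp
    \<comment> \<open>Vertices in exactly one of the two transversals are dropped; the remaining
      ones have disjoint stars to the union.\<close>
    have "?P (E h \<inter> E g) \<le> ?P {f. \<forall>v\<in>{..<n} - (?A \<union> ?B). (\<exists>a\<in>?A. f {v, a}) \<and> (\<exists>b\<in>?B. f {v, b})}"
      by (rule measure_pmf.finite_measure_mono) (auto simp: E_def)
    also have "\<dots> = (1 - q ^ card ?A - q ^ card ?B + q ^ card (?A \<union> ?B)) ^ card ({..<n} - (?A \<union> ?B))"
      unfolding q_def using sub[OF h] sub[OF g] p by (intro prob_all_dominated) auto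
    also have "card ({..<n} - (?A \<union> ?B)) = n - (2 * k - j)"
      using fin sub[OF h] sub[OF g] by (simp add: card_Diff_subset AB)
    also have "(1 - q ^ card ?A - q ^ card ?B + q ^ card (?A \<union> ?B)) ^ (n - (2 * k - j)) \<le>
        ((1 - Q) ^ (n - k))\<^sup>2 * (n powr (3/5)) ^ j / (1 - 2 * k * Q)"
      unfolding AB card[OF h] card[OF g] Q_def[symmetric]
      using q k j Q by (intro pair_domination_bound) (auto simp: Q_def q_def)
    finally show ?thesis
      by (simp add: a_def T_def L_def j_def)
  qed
  have "(\<Sum>h\<in>F. \<Sum>g\<in>F. ?P (E h \<inter> E g)) \<le>
      (\<Sum>h\<in>F. \<Sum>g\<in>F. a\<^sup>2 / L * T ^ card {i \<in> {..<k}. h i = g i})"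
    using pair by (intro sum_mono) auto
  also have "\<dots> = (\<Sum>h\<in>F. a\<^sup>2 / L * (real m - 1 + T) ^ k)"
    unfolding F_def sum_distrib_left[symmetric]
    by (intro sum.cong refl arg_cong2[where f = "(*)"] sum_power_agreements) (auto simp: PiE_iff)
  also have "\<dots> = m ^ k * (a\<^sup>2 / L) * (real m - 1 + T) ^ k"
    by (simp add: F)
  also have "\<dots> \<le> m ^ k * (a\<^sup>2 / L) * (m * exp (T / m)) ^ k"
  proof (intro mult_left_mono power_mono)
    have "real m - 1 + T \<le> m * (1 + T / m)"
      using m by (simp add: field_simps)
    also have "\<dots> \<le> m * exp (T / m)"
      by (intro mult_left_mono) auto
    finally show "real m - 1 + T \<le> m * exp (T / m)" .
    have "1 \<le> real m" "0 \<le> T"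
      using m by (auto simp: T_def)
    then show "0 \<le> real m - 1 + T"
      by linarith
  qed (use L in simp)
  also have "(m * exp (T / m)) ^ k = m ^ k * exp (k * T / m)"
    by (simp add: power_mult_distrib exp_of_nat_mult[symmetric])
  also have "m ^ k * (a\<^sup>2 / L) * (m ^ k * exp (k * T / m)) =
      (1 + (exp (k * T / m) / L - 1)) * (card F * a)\<^sup>2"
    by (simp add: F power2_eq_square)
  finally have pairs: "(\<Sum>h\<in>F. \<Sum>g\<in>F. ?P (E h \<inter> E g)) \<le>
      (1 + (exp (k * T / m) / L - 1)) * (card F * a)\<^sup>2" .
  have "{f. \<not> (\<exists>A\<subseteq>{..<n}. card A = k \<and> (\<forall>v\<in>{..<n} - A. \<exists>a\<in>A. f {v, a}))}
      \<subseteq> {f. \<forall>h\<in>F. f \<notin> E h}"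
    using sub card by (force simp: E_def)
  then have "?P {f. \<not> (\<exists>A\<subseteq>{..<n}. card A = k \<and> (\<forall>v\<in>{..<n} - A. \<exists>a\<in>A. f {v, a}))}
      \<le> ?P {f. \<forall>h\<in>F. f \<notin> E h}"
    by (rule measure_pmf.finite_measure_mono) simp
  also have "\<dots> \<le> exp (k * T / m) / L - 1"
    using F(1,2) a single pairs by (rule prob_none_le_second_moment)
  finally show ?thesis
    by (simp add: T_def L_def m_def Q_def q_def)
qed

section \<open>Conflict-free colorings of random graphs\<close>

definition coin_graph :: "nat \<Rightarrow> (nat set \<Rightarrow> bool) \<Rightarrow> nat ugraph" where
  "coin_graph n f = \<lparr>verts = {..<n}, edges = {e \<in> all_pairs {..<n}. f e}\<rparr>"

text \<open>\<^term>\<open>served f S v\<close> is what remains of "\<open>v\<close> sees the color of a class exactly once" when the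
  class is replaced by a subset \<open>S\<close> of size at most 3, equal to the class if the size is less than 3.\<close>

definition served :: "(nat set \<Rightarrow> bool) \<Rightarrow> nat set \<Rightarrow> nat \<Rightarrow> bool" where
  "served f S v \<longleftrightarrow> card {s \<in> S. f {v, s}} = 1 \<or> card S = 3 \<and> card {s \<in> S. f {v, s}} = 0"

lemma nbhd_coin_graph: "v < n \<Longrightarrow> nbhd (coin_graph n f) v = {s \<in> {..<n} - {v}. f {v, s}}"
  by (auto simp: nbhd_def coin_graph_def all_pairs_def card_insert_if)

text \<open>With \<open>q = 1 - p \<le> 1/2\<close>, sizes 0 to 3 give 0, \<open>p\<close>,
  \<open>2 * p * q\<close> and \<open>q^2 * (3 - 2 * q)\<close>; the last is at most
  \<open>q\<close> because \<open>(1 - q) * (1 - 2 * q) \<ge> 0\<close>. Triples are the right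
  cut-off for larger classes: at most one neighbor in a pair has probability \<open>1 - p^2\<close>,
  which exceeds \<open>p\<close> at \<open>p = 1/2\<close>.\<close>

lemma prob_served_le:
  assumes "v < n" "S \<subseteq> {..<n}" "v \<notin> S" "card S \<le> 3" and p: "1 / 2 \<le> p" "p \<le> 1"
  shows "measure_pmf.prob (coins n p) {f. served f S v} \<le> p"
proof -
  let ?s = "card S"
  have p01: "p \<in> {0..1}"
    using p by auto
  have "measure_pmf.prob (coins n p) {f. served f S v} =
      measure_pmf.prob (binomial_pmf ?s p) {t. t = 1 \<or> ?s = 3 \<and> t = 0}"
    unfolding served_def using assms p01 by (intro prob_card_neighbours) auto
  also have "\<dots> = (\<Sum>t\<in>(if ?s = 3 then {0, 1} else {1}). pmf (binomial_pmf ?s p) t)"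
    by (subst measure_measure_pmf_finite[symmetric]) (auto intro!: arg_cong2[where f = measure])
  also have "\<dots> \<le> p"
  proof -
    consider "?s = 0" | "?s = 1" | "?s = 2" | "?s = 3"
      using assms(4) by linarith
    then show ?thesis
    proof cases
      case 3
      then show ?thesis
        using p p01 mult_left_mono[of "2 * (1 - p)" 1 p] by simp
    next
      case 4
      have "(1 - (1 - p)) * (1 - 2 * (1 - p)) \<ge> 0"
        using p by (intro mult_nonneg_nonneg) auto
      then have "(1 - p) * (3 - 2 * (1 - p)) \<le> 1"
        by (simp add: algebra_simps)
      then have "(1 - p) * ((1 - p) * (3 - 2 * (1 - p))) \<le> (1 - p) * 1"
        using p by (intro mult_left_mono) auto
      also have "\<dots> \<le> p"
        using p by simp
      finally show ?thesis
        using 4 p p01 by (simp add: power2_eq_square power3_eq_cube algebra_simps)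
    qed (use p p01 in simp_all)
  qed
  finally show ?thesis .
qed

text \<open>Independence is used twice: across the vertices outside the union, through their stars
  to it, and for one vertex across the disjoint sets \<open>S i\<close>. A single vertex is thus
  unserved with probability at least \<open>(1 - p) ^ r\<close>, and the union has at most
  \<open>3 * r\<close> vertices.\<close>

lemma prob_all_served_le:
  assumes S: "\<And>i. i < r \<Longrightarrow> S i \<subseteq> {..<n}" "\<And>i. i < r \<Longrightarrow> card (S i) \<le> 3"
    and disj: "disjoint_family_on S {..<r}" and p: "1 / 2 \<le> p" "p \<le> 1"
  shows "measure_pmf.prob (coins n p)
      {f. \<forall>v\<in>{..<n} - (\<Union>i<r. S i). \<exists>i<r. served f (S i) v} \<le> (1 - (1 - p) ^ r) ^ (n - 3 * r)"
proof -
  let ?P = "measure_pmf.prob (coins n p)"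
  define U where "U = (\<Union>i<r. S i)"
  have U: "U \<subseteq> {..<n}"
    using S by (auto simp: U_def)
  then have finU: "finite U"
    by (rule finite_subset) simp
  have served_cong: "served f (S i) v = served g (S i) v"
    if "\<And>e. e \<in> star v (S i) \<Longrightarrow> f e = g e" for f g v i
  proof -
    have "{s \<in> S i. f {v, s}} = {s \<in> S i. g {v, s}}"
      using that by (auto simp: star_def)
    then show ?thesis
      by (simp add: served_def)
  qed
  have q01: "0 \<le> (1 - p) ^ r" "(1 - p) ^ r \<le> 1"
    using p by (auto intro: power_le_one)
  have "?P {f. \<forall>v\<in>{..<n} - U. \<exists>i<r. served f (S i) v} =
      (\<Prod>v\<in>{..<n} - U. ?P {f. \<exists>i<r. served f (S i) v})"
  proof (rule prob_Pi_pmf_INT[where B = "\<lambda>v. star v U"])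
    show "disjoint_family_on (\<lambda>v. star v U) ({..<n} - U)"
      unfolding disjoint_family_on_def by (intro ballI impI star_disjoint) auto
    show "star v U \<subseteq> all_pairs {..<n}" if "v \<in> {..<n} - U" for v
      using U that by (intro star_subset) auto
    show "(\<exists>i<r. served f (S i) v) = (\<exists>i<r. served g (S i) v)"
      if "\<And>e. e \<in> star v U \<Longrightarrow> f e = g e" for v f g
    proof -
      have "served f (S i) v = served g (S i) v" if "i < r" for i
        by (rule served_cong, rule \<open>\<And>e. e \<in> star v U \<Longrightarrow> f e = g e\<close>) (use that in \<open>auto simp: star_def U_def\<close>)
      then show ?thesis
        by blast
    qed
  qed (simp_all add: finite_all_pairs)
  also have "\<dots> \<le> (\<Prod>v\<in>{..<n} - U. 1 - (1 - p) ^ r)"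
  proof (rule prod_mono)
    fix v assume "v \<in> {..<n} - U"
    then have v: "v < n" "\<And>i. i < r \<Longrightarrow> v \<notin> S i"
      by (auto simp: U_def)
    have "(1 - p) ^ r = (\<Prod>i<r. 1 - p)"
      by simp
    also have "\<dots> \<le> (\<Prod>i<r. ?P {f. \<not> served f (S i) v})"
    proof (rule prod_mono)
      fix i assume "i \<in> {..<r}"
      then have "?P {f. served f (S i) v} \<le> p"
        using v S p by (intro prob_served_le) auto
      moreover have "?P {f. \<not> served f (S i) v} = 1 - ?P {f. served f (S i) v}"
        using measure_pmf.prob_compl[of "{f. served f (S i) v}" "coins n p"]
        by (simp add: Compl_eq_Diff_UNIV[symmetric] Collect_neg_eq)
      ultimately show "0 \<le> 1 - p \<and> 1 - p \<le> ?P {f. \<not> served f (S i) v}"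
        using p by simp
    qed
    also have "\<dots> = ?P {f. \<forall>i\<in>{..<r}. \<not> served f (S i) v}"
    proof (rule prob_Pi_pmf_INT[where B = "\<lambda>i. star v (S i)", symmetric])
      show "disjoint_family_on (\<lambda>i. star v (S i)) {..<r}"
        using disj unfolding disjoint_family_on_def by (simp add: star_disjoint')
      show "star v (S i) \<subseteq> all_pairs {..<n}" if "i \<in> {..<r}" for i
        using that v S by (intro star_subset) auto
      show "(\<not> served f (S i) v) = (\<not> served g (S i) v)"
        if "\<And>e. e \<in> star v (S i) \<Longrightarrow> f e = g e" for i f g
        using served_cong[of v i f g] that by simp
    qed (simp_all add: finite_all_pairs)
    also have "\<dots> = 1 - ?P {f. \<exists>i<r. served f (S i) v}"
    proof -
      have "{f. \<forall>i\<in>{..<r}. \<not> served f (S i) v} = UNIV - {f. \<exists>i<r. served f (S i) v}"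
        by auto
      then show ?thesis
        using measure_pmf.prob_compl[of "{f. \<exists>i<r. served f (S i) v}" "coins n p"] by simp
    qed
    finally show "0 \<le> ?P {f. \<exists>i<r. served f (S i) v} \<and>
        ?P {f. \<exists>i<r. served f (S i) v} \<le> 1 - (1 - p) ^ r"
      by simp
  qed
  also have "\<dots> = (1 - (1 - p) ^ r) ^ card ({..<n} - U)"
    by simp
  also have "\<dots> \<le> (1 - (1 - p) ^ r) ^ (n - 3 * r)"
  proof (rule power_decreasing)
    have "card U \<le> (\<Sum>i<r. card (S i))"
      unfolding U_def by (rule card_UN_le) simp
    then have "card U \<le> 3 * r"
      using sum_bounded_above[of "{..<r}" "\<lambda>i. card (S i)" 3] S(2) by simp
    moreover have "card ({..<n} - U) = card {..<n} - card U"
      using finU U by (rule card_Diff_subset)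
    moreover have "card {..<n} = n"
      by (rule card_lessThan)
    ultimately show "n - 3 * r \<le> card ({..<n} - U)"
      by linarith
    show "0 \<le> 1 - (1 - p) ^ r" "1 - (1 - p) ^ r \<le> 1"
      using q01 by linarith+
  qed
  finally show ?thesis
    unfolding U_def .
qed

lemma conflict_free_served:
  assumes c: "c \<in> {..<n} \<rightarrow> {..<r}" and cf: "conflict_free (coin_graph n f) c"
  shows "\<exists>S\<in>PiE {..<r} (\<lambda>_. {S. S \<subseteq> {..<n} \<and> card S \<le> 3}).
    disjoint_family_on S {..<r} \<and> (\<forall>v\<in>{..<n} - (\<Union>i<r. S i). \<exists>i<r. served f (S i) v)"
proof -
  define C where "C i = {v \<in> {..<n}. c v = i}" for i
  have "\<exists>S. S \<subseteq> C i \<and> card S \<le> 3 \<and> (card S < 3 \<longrightarrow> S = C i)" for i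
  proof (cases "card (C i) \<le> 3")
    case False
    then obtain S where "S \<subseteq> C i" "card S = 3"
      using obtain_subset_with_card_n[of 3 "C i"] by auto
    then show ?thesis
      by (intro exI[of _ S]) simp
  qed auto
  then obtain S0 where S0: "\<And>i. S0 i \<subseteq> C i" "\<And>i. card (S0 i) \<le> 3"
    "\<And>i. card (S0 i) < 3 \<Longrightarrow> S0 i = C i"
    by metis
  \<comment> \<open>Restriction to the \<open>r\<close> colors places the choice in a finite
    function space, over which a union bound is possible.\<close>
  define S where "S = restrict S0 {..<r}"
  have S: "S i = S0 i" if "i < r" for i
    using that by (simp add: S_def)
  have "S \<in> PiE {..<r} (\<lambda>_. {S. S \<subseteq> {..<n} \<and> card S \<le> 3})"
    using S0 by (fastforce simp: S_def C_def)
  moreover have "disjoint_family_on S {..<r}"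
  proof -
    have "S0 i \<inter> S0 j = {}" if "i \<noteq> j" for i j
      using S0(1)[of i] S0(1)[of j] that by (auto simp: C_def)
    then show ?thesis
      by (simp add: disjoint_family_on_def S)
  qed
  moreover have "\<forall>v\<in>{..<n} - (\<Union>i<r. S i). \<exists>i<r. served f (S i) v"
  proof
    fix v assume v: "v \<in> {..<n} - (\<Union>i<r. S i)"
    let ?N = "closed_nbhd (coin_graph n f) v"
    have N: "?N = insert v {s \<in> {..<n} - {v}. f {v, s}}"
      using v by (simp add: closed_nbhd_def nbhd_coin_graph)
    obtain y where y: "y \<in> ?N" "\<And>z. z \<in> ?N \<Longrightarrow> z \<noteq> y \<Longrightarrow> c y \<noteq> c z"
    proof -
      have "v \<in> verts (coin_graph n f)"
        using v by (simp add: coin_graph_def)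
      with cf that show ?thesis
        unfolding conflict_free_def by blast
    qed
    define i where "i = c y"
    have "y < n"
      using y(1) v N by auto
    then have i: "i < r"
      using c by (auto simp: i_def)
    have vS: "v \<notin> S0 i"
      using v i S by auto
    have sub: "{s \<in> S0 i. f {v, s}} \<subseteq> {y}"
    proof
      fix s assume s: "s \<in> {s \<in> S0 i. f {v, s}}"
      then have "s \<in> ?N" "c s = c y"
        using S0(1)[of i] vS by (auto simp: N C_def i_def)
      then show "s \<in> {y}"
        using y(2)[of s] by auto
    qed
    have "card {s \<in> S0 i. f {v, s}} \<le> 1"
      using card_mono[OF _ sub] by simp
    \<comment> \<open>Here \<open>S0 i\<close> is the whole class and omits \<open>v\<close>, so
      \<open>y\<close> is a genuine neighbor in \<open>S0 i\<close>. For a triple, \<open>y\<close>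
      may be \<open>v\<close> itself or another vertex outside the triple, whence the count 0 is
      also allowed.\<close>
    moreover have "card {s \<in> S0 i. f {v, s}} = 1" if "card (S0 i) < 3"
    proof -
      have "y \<in> S0 i"
        using S0(3)[OF that] \<open>y < n\<close> by (simp add: C_def i_def)
      then have "{s \<in> S0 i. f {v, s}} = {y}"
        using sub y(1) vS N by auto
      then show ?thesis
        by simp
    qed
    ultimately have "served f (S0 i) v"
      using S0(2)[of i] unfolding served_def by linarith
    then show "\<exists>i<r. served f (S i) v"
      using i S by auto
  qed
  ultimately show ?thesis
    by (intro bexI[of _ S] conjI)
qed

lemma card_subsets_card_le_3: "card {S. S \<subseteq> {..<n} \<and> card S \<le> 3} \<le> (n + 1) ^ 3"
proof -
  have "{S. S \<subseteq> {..<n} \<and> card S \<le> 3} \<subseteq>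
      (\<lambda>(a, b, c). {a, b, c} \<inter> {..<n}) ` ({..n} \<times> {..n} \<times> {..n})"
  proof
    fix S assume "S \<in> {S. S \<subseteq> {..<n} \<and> card S \<le> 3}"
    then have S: "S \<subseteq> {..<n}" "card S \<le> 3"
      by auto
    then obtain xs where xs: "set xs = S" "length xs = card S"
      using finite_subset[OF S(1)] by (metis distinct_card finite_distinct_list finite_lessThan)
    define x where "x i = (if i < length xs then xs ! i else n)" for i
    have "S = {x 0, x 1, x 2} \<inter> {..<n}"
    proof
      show "S \<subseteq> {x 0, x 1, x 2} \<inter> {..<n}"
      proof
        fix s assume "s \<in> S"
        then obtain i where "i < length xs" "s = xs ! i"
          using xs by (metis in_set_conv_nth)
        moreover from this have "i = 0 \<or> i = 1 \<or> i = 2"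
          using S(2) xs by linarith
        ultimately show "s \<in> {x 0, x 1, x 2} \<inter> {..<n}"
          using S(1) \<open>s \<in> S\<close> by (auto simp: x_def)
      qed
      show "{x 0, x 1, x 2} \<inter> {..<n} \<subseteq> S"
        using xs(1) nth_mem by (auto simp: x_def split: if_splits)
    qed
    moreover have "x i \<le> n" for i
    proof (cases "i < length xs")
      case True
      then have "xs ! i \<in> {..<n}"
        using S(1) xs(1) nth_mem by blast
      then show ?thesis
        using True by (simp add: x_def)
    qed (simp add: x_def)
    ultimately show "S \<in> (\<lambda>(a, b, c). {a, b, c} \<inter> {..<n}) ` ({..n} \<times> {..n} \<times> {..n})"
      by (intro image_eqI[of _ _ "(x 0, x 1, x 2)"]) auto
  qed
  then have "card {S. S \<subseteq> {..<n} \<and> card S \<le> 3} \<le> card ({..n} \<times> {..n} \<times> {..n})"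
    by (intro surj_card_le) auto
  also have "\<dots> = (n + 1) ^ 3"
    by (simp add: card_cartesian_product power3_eq_cube)
  finally show ?thesis .
qed

text \<open>Union bound over families of small disjoint sets. There are at most
  \<open>(n + 1) ^ (3 * r)\<close> of these, whereas the colorings themselves would be far too
  many.\<close>

lemma prob_conflict_free_le:
  assumes p: "1 / 2 \<le> p" "p \<le> 1"
  shows "measure_pmf.prob (coins n p)
      {f. \<exists>c::nat \<Rightarrow> nat. c \<in> {..<n} \<rightarrow> {..<r} \<and> conflict_free (coin_graph n f) c}
    \<le> real ((n + 1) ^ (3 * r)) * (1 - (1 - p) ^ r) ^ (n - 3 * r)"
proof -
  let ?P = "measure_pmf.prob (coins n p)"
  define \<S> where "\<S> = {S \<in> PiE {..<r} (\<lambda>_. {S. S \<subseteq> {..<n} \<and> card S \<le> 3}). disjoint_family_on S {..<r}}"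
  define E where "E S = {f. \<forall>v\<in>{..<n} - (\<Union>i<r. S i). \<exists>i<r. served f (S i) v}" for S :: "nat \<Rightarrow> nat set"
  have finPiE: "finite (PiE {..<r} (\<lambda>_. {S. S \<subseteq> {..<n} \<and> card S \<le> 3}))"
    by (intro finite_PiE) auto
  then have fin: "finite \<S>"
    by (simp add: \<S>_def)
  have q: "(1 - p) ^ r \<le> 1"
    using p by (intro power_le_one) auto
  have "card \<S> \<le> card (PiE {..<r} (\<lambda>_. {S. S \<subseteq> {..<n} \<and> card S \<le> 3}))"
    unfolding \<S>_def by (rule card_mono[OF finPiE]) auto
  also have "\<dots> = card {S. S \<subseteq> {..<n} \<and> card S \<le> 3} ^ r"
    by (simp add: card_PiE)
  also have "\<dots> \<le> ((n + 1) ^ 3) ^ r"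
    by (intro power_mono card_subsets_card_le_3) simp
  finally have card: "card \<S> \<le> (n + 1) ^ (3 * r)"
    by (simp only: power_mult)
  have "{f. \<exists>c::nat \<Rightarrow> nat. c \<in> {..<n} \<rightarrow> {..<r} \<and> conflict_free (coin_graph n f) c} \<subseteq> (\<Union>S\<in>\<S>. E S)"
  proof
    fix f assume "f \<in> {f. \<exists>c::nat \<Rightarrow> nat. c \<in> {..<n} \<rightarrow> {..<r} \<and> conflict_free (coin_graph n f) c}"
    then obtain c :: "nat \<Rightarrow> nat" where "c \<in> {..<n} \<rightarrow> {..<r}" "conflict_free (coin_graph n f) c"
      by auto
    from conflict_free_served[OF this] obtain S where "S \<in> \<S>" "f \<in> E S"
      unfolding \<S>_def E_def by blast
    then show "f \<in> (\<Union>S\<in>\<S>. E S)"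
      by auto
  qed
  then have "?P {f. \<exists>c::nat \<Rightarrow> nat. c \<in> {..<n} \<rightarrow> {..<r} \<and> conflict_free (coin_graph n f) c}
      \<le> ?P (\<Union>S\<in>\<S>. E S)"
    by (rule measure_pmf.finite_measure_mono) simp
  also have "\<dots> \<le> (\<Sum>S\<in>\<S>. ?P (E S))"
    by (rule measure_pmf.finite_measure_subadditive_finite[OF fin]) simp
  also have "\<dots> \<le> (\<Sum>S\<in>\<S>. (1 - (1 - p) ^ r) ^ (n - 3 * r))"
    unfolding E_def using p by (intro sum_mono prob_all_served_le) (auto simp: \<S>_def PiE_iff)
  also have "\<dots> = card \<S> * (1 - (1 - p) ^ r) ^ (n - 3 * r)"
    by simp
  also have "\<dots> \<le> real ((n + 1) ^ (3 * r)) * (1 - (1 - p) ^ r) ^ (n - 3 * r)"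
  proof (rule mult_right_mono)
    show "real (card \<S>) \<le> real ((n + 1) ^ (3 * r))"
      using card by (rule of_nat_mono)
    show "0 \<le> (1 - (1 - p) ^ r) ^ (n - 3 * r)"
      using q by simp
  qed
  finally show ?thesis .
qed

section \<open>Asymptotics\<close>

text \<open>Take the least \<open>k \<ge> 4\<close> satisfying the inequality; starting at 4 keeps
  \<open>k - 4\<close> a genuine difference. A failing \<open>j \<ge> 4\<close> has
  \<open>1 \<le> j / 2 * ln n < n / 2 ^ j\<close>, hence \<open>j < log 2 n\<close>. This gives
  existence and, applied to \<open>k - 1\<close>, the logarithmic bound.\<close>

lemma domination_threshold:
  fixes q :: real and n :: nat
  assumes q: "0 \<le> q" "q \<le> 1 / 2" and n: "1 \<le> ln n"
  obtains k :: nat where "4 \<le> k" "k \<le> 5 + log 2 n" "n * q ^ k \<le> k / 2 * ln n"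
    "k = 4 \<or> (real k - 1) / 2 * ln n < n * q ^ (k - 1)"
proof -
  define R where "R k \<longleftrightarrow> 4 \<le> k \<and> n * q ^ k \<le> k / 2 * ln n" for k :: nat
  have n0: "n > 0"
    using n by (cases n) auto
  have low: "j < log 2 n" if "4 \<le> j" "\<not> R j" for j :: nat
  proof -
    have "1 * 1 \<le> j / 2 * ln n"
      using that n by (intro mult_mono) auto
    also have "\<dots> < n * q ^ j"
      using that by (simp add: R_def)
    also have "\<dots> \<le> n * (1 / 2) ^ j"
      using q by (intro mult_left_mono power_mono) auto
    finally have "2 ^ j < real n"
      by (simp add: field_simps power_divide)
    then have "2 powr j < n"
      by (simp add: powr_realpow)
    then show ?thesis
      using n0 by (simp add: less_log_iff)
  qed
  have "\<exists>k. R k"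
  proof (rule ccontr)
    assume "\<nexists>k. R k"
    then have "real (4 + nat \<lceil>log 2 n\<rceil>) < log 2 n"
      by (intro low) auto
    then show False
      by linarith
  qed
  define k where "k = (LEAST k. R k)"
  have k: "R k"
    unfolding k_def using \<open>\<exists>k. R k\<close> by (rule LeastI_ex)
  have k4: "k = 4 \<or> 4 \<le> k - 1 \<and> \<not> R (k - 1)"
    using k not_less_Least[of "k - 1" R] unfolding k_def[symmetric] by (auto simp: R_def)
  have "log 2 n \<ge> 0"
    using n0 by simp
  then have "k \<le> 5 + log 2 n"
    using k4 low[of "k - 1"] by auto
  moreover have "k = 4 \<or> (real k - 1) / 2 * ln n < n * q ^ (k - 1)"
    using k4 by (auto simp: R_def of_nat_diff)
  ultimately show ?thesis
    using k that by (auto simp: R_def)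
qed

text \<open>For \<open>k = 4\<close> there are no colors and the left side is 0. Otherwise put
  \<open>r = k - 4\<close>: the choices contribute about \<open>3 * r * ln n\<close> to the
  exponent, and the failures of single vertices about \<open>- 4 * (r + 3) * ln n\<close>.\<close>

lemma coloring_count_bound:
  fixes q :: real and n k :: nat
  assumes q: "0 \<le> q" "q \<le> 1 / 2" and n: "9 / 2 \<le> ln n" and k: "4 \<le> k"
    "k = 4 \<or> (real k - 1) / 2 * ln n < n * q ^ (k - 1)"
  shows "real ((n + 1) ^ (3 * (k - 4))) * (1 - q ^ (k - 4)) ^ (n - 3 * (k - 4)) \<le> 1 / n"
proof (cases "k = 4")
  case True
  have "n > 0"
    using n by (cases n) auto
  then show ?thesis
    using True by (simp add: power_0_left)
next
  case False
  define r where "r = k - 4"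
  have r: "k - 1 = r + 3" "real k - 1 = r + 3" "1 \<le> r"
    using k(1) False by (auto simp: r_def)
  have n0: "n > 0"
    using n by (cases n) auto
  have qr: "0 \<le> q ^ r" "q ^ r \<le> 1 / 2"
    using q r(3) power_decreasing[of 1 r q] by auto
  \<comment> \<open>Passing from \<open>k - 1\<close> to \<open>r\<close> removes three factors
    \<open>q\<close>, a gain of at least 8, which turns \<open>(r + 3) / 2\<close> into
    \<open>4 * (r + 3)\<close>.\<close>
  have "q ^ 3 \<le> (1 / 2) ^ 3"
    using q by (intro power_mono) auto
  then have "n * q ^ r * q ^ 3 \<le> n * q ^ r * (1 / 8)"
    using qr by (intro mult_left_mono) (auto simp: power_divide)
  moreover have "(r + 3) / 2 * ln n < n * q ^ r * q ^ 3"
    using k(2) False unfolding r by (simp add: power_add mult.assoc)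
  ultimately have nq: "4 * (r + 3) * ln n \<le> n * q ^ r"
    by (simp add: field_simps)
  have "1 - q ^ r \<le> exp (- (q ^ r))"
    using exp_ge_add_one_self[of "- (q ^ r)"] by simp
  then have "(1 - q ^ r) ^ (n - 3 * r) \<le> exp (- (q ^ r)) ^ (n - 3 * r)"
    using qr by (intro power_mono) auto
  also have "\<dots> = exp (- (real (n - 3 * r) * q ^ r))"
    by (simp add: exp_of_nat_mult[symmetric])
  \<comment> \<open>The \<open>3 * r\<close> excluded vertices cost at most \<open>3 * r / 2\<close>
    in the exponent, since \<open>q ^ r \<le> 1/2\<close>. Together with the \<open>3 * r\<close>
    from \<open>n + 1 \<le> exp 1 * n\<close> below, this is the origin of 9/2.\<close>
  also have "\<dots> \<le> exp (3 / 2 * r - 4 * (r + 3) * ln n)"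
  proof -
    have "(n - 3 * real r) * q ^ r \<le> real (n - 3 * r) * q ^ r"
      using qr by (intro mult_right_mono) auto
    moreover have "3 * real r * q ^ r \<le> 3 * real r * (1 / 2)"
      using qr by (intro mult_left_mono) auto
    ultimately show ?thesis
      using nq by (simp add: algebra_simps)
  qed
  finally have exp1: "(1 - q ^ r) ^ (n - 3 * r) \<le> exp (3 / 2 * r - 4 * (r + 3) * ln n)" .
  have "real (n + 1) \<le> 2 * real n"
    using n0 by simp
  also have "\<dots> \<le> exp 1 * n"
    using exp_ge_add_one_self[of 1] by (intro mult_right_mono) auto
  also have "\<dots> = exp (1 + ln n)"
    using n0 by (simp add: exp_add)
  finally have "real (n + 1) ^ (3 * r) \<le> exp (1 + ln n) ^ (3 * r)"
    by (intro power_mono) auto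
  also have "\<dots> = exp (3 * r * (1 + ln n))"
    by (simp add: exp_of_nat_mult[symmetric])
  finally have "real (n + 1) ^ (3 * r) * (1 - q ^ r) ^ (n - 3 * r) \<le>
      exp (3 * r * (1 + ln n)) * exp (3 / 2 * r - 4 * (r + 3) * ln n)"
    using exp1 qr by (intro mult_mono) auto
  also have "\<dots> = exp (r * (9 / 2 - ln n) - 12 * ln n)"
    by (simp add: exp_add[symmetric] algebra_simps)
  also have "\<dots> \<le> exp (- ln n)"
    using n mult_nonneg_nonpos[of "real r" "9 / 2 - ln n"] by simp
  also have "\<dots> = 1 / n"
    using n0 by (simp add: exp_minus inverse_eq_divide)
  finally show ?thesis
    by (simp add: r_def add.commute)
qed

text \<open>The term \<open>1 / n\<close> pays for colorings with too few colors, the rest for the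
  lack of a small dominating set, with \<open>k\<close> replaced by its bound
  \<open>5 + log 2 n\<close>. No edge probability occurs, so convergence is uniform in
  \<open>p\<close>.\<close>

definition failure_bound :: "nat \<Rightarrow> real" where
  "failure_bound n = 1 / n + (exp (2 * (5 + log 2 n)\<^sup>2 * n powr (3/5) / n)
     / (1 - (5 + log 2 n)\<^sup>2 * ln n / n) - 1)"

lemma failure_bound_tendsto_0: "failure_bound \<longlonglongrightarrow> 0"
  unfolding failure_bound_def[abs_def] by real_asymp

lemma eventually_large_enough:
  "\<forall>\<^sub>F n in sequentially. 2 * (5 + log 2 (real n)) \<le> real n \<and>
     (5 + log 2 n)\<^sup>2 * ln n / n < 1 \<and> 9 / 2 \<le> ln (real n)"
  by (intro eventually_conj; real_asymp)

section \<open>From coins back to graphs, and the final estimate\<close>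

lemma prob_erdos_renyi:
  "measure_pmf.prob (erdos_renyi n p) {G. R G} = measure_pmf.prob (coins n p) {f. R (coin_graph n f)}"
  by (simp add: erdos_renyi_def coin_graph_def vimage_def)

lemma domination_number_coin_graph_le:
  assumes "A \<subseteq> {..<n}" "\<forall>v\<in>{..<n} - A. \<exists>a\<in>A. f {v, a}"
  shows "domination_number (coin_graph n f) \<le> card A"
proof (rule domination_number_le)
  have "\<exists>a\<in>A. {a, v} \<in> edges (coin_graph n f)" if v: "v \<in> {..<n} - A" for v
  proof -
    obtain a where "a \<in> A" "f {v, a}"
      using assms(2) v by blast
    moreover from this have "a \<noteq> v" "a < n"
      using v assms(1) by auto
    ultimately show ?thesis
      using v by (intro bexI[of _ a]) (auto simp: coin_graph_def all_pairs_def insert_commute)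
  qed
  then show "dominating_set (coin_graph n f) A"
    using assms(1) by (auto simp: dominating_set_def coin_graph_def)
qed

lemma cf_chromatic_number_coin_graph_gt:
  assumes "\<not> (\<exists>c::nat \<Rightarrow> nat. c \<in> {..<n} \<rightarrow> {..<r} \<and> conflict_free (coin_graph n f) c)"
  shows "r < cf_chromatic_number (coin_graph n f)"
proof (rule ccontr)
  assume le: "\<not> r < cf_chromatic_number (coin_graph n f)"
  have "finite_simple_graph (coin_graph n f)"
    by (auto simp: finite_simple_graph_def coin_graph_def)
  then obtain c :: "nat \<Rightarrow> nat"
    where c: "c \<in> verts (coin_graph n f) \<rightarrow> {..<cf_chromatic_number (coin_graph n f)}"
      "conflict_free (coin_graph n f) c"
    using cf_chromatic_number_coloring by blast
  have "c \<in> {..<n} \<rightarrow> {..<r}"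
    using c(1) le by (force simp: coin_graph_def)
  with c(2) assms show False
    by blast
qed

lemma prob_lower_bound_ge:
  fixes p :: real
  assumes p: "1 / 2 \<le> p" "p \<le> 1"
    and n: "2 * (5 + log 2 (real n)) \<le> n" "(5 + log 2 n)\<^sup>2 * ln n / n < 1" "9 / 2 \<le> ln (real n)"
  shows "1 - failure_bound n \<le> measure_pmf.prob (erdos_renyi n p)
    {G. int (domination_number G) - 3 \<le> int (cf_chromatic_number G)}"
proof -
  let ?P = "measure_pmf.prob (coins n p)"
  define q where "q = 1 - p"
  have q: "0 \<le> q" "q \<le> 1 / 2"
    using p by (auto simp: q_def)
  obtain k :: nat where k: "4 \<le> k" "k \<le> 5 + log 2 n" "n * q ^ k \<le> k / 2 * ln n"
    "k = 4 \<or> (real k - 1) / 2 * ln n < n * q ^ (k - 1)"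
    using domination_threshold[OF q, of n] n(3) by auto
  define K where "K = 5 + log 2 n"
  have n0: "n > 0"
    using n(3) by (cases n) auto
  have K: "real k \<le> K" "K\<^sup>2 * ln n / n < 1"
    using k n by (auto simp: K_def)
  have kK: "(real k)\<^sup>2 \<le> K\<^sup>2"
    using K(1) by (intro power_mono) auto
  have kn: "2 * k \<le> n"
  proof -
    have "real (2 * k) \<le> real n"
      using k(2) n(1) by simp
    then show ?thesis
      by (simp only: of_nat_le_iff)
  qed
  \<comment> \<open>The threshold inequality multiplied by \<open>2 * k / n\<close>.\<close>
  have "2 * k * q ^ k = 2 * k * (n * q ^ k) / n"
    using n0 by simp
  also have "\<dots> \<le> 2 * k * (k / 2 * ln n) / n"
    using k(3) by (intro divide_right_mono mult_left_mono) auto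
  also have "\<dots> = (real k)\<^sup>2 * ln n / n"
    by (simp add: power2_eq_square)
  also have "\<dots> \<le> K\<^sup>2 * ln n / n"
    using kK n(3) by (intro divide_right_mono mult_right_mono) auto
  finally have Q: "2 * k * q ^ k \<le> K\<^sup>2 * ln n / n" .
  then have Q1: "2 * k * q ^ k < 1"
    using K(2) by linarith
  define m where "m = n div k"
  have m: "m \<ge> 1"
    unfolding m_def using k(1) kn by (simp add: Suc_leI div_greater_zero_iff)
  \<comment> \<open>As \<open>m \<ge> 1\<close>, rounding down in \<open>n div k\<close> loses at
    most a factor 2.\<close>
  have "n < k * (m + 1)"
    using k(1) unfolding m_def by (metis add.commute dividend_less_div_times mult.commute
        mult_Suc_right Suc_eq_plus1 zero_less_numeral order_less_le_trans)
  also have "\<dots> \<le> k * (2 * m)"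
    using m by (intro mult_le_mono2) simp
  finally have nkm: "real n \<le> 2 * (k * m)"
    by (metis less_imp_le mult.left_commute of_nat_le_iff of_nat_mult of_nat_numeral)
  have "1 / real m \<le> 2 * k / n"
    using nkm m n0 by (simp add: field_simps)
  then have "(k * n powr (3/5)) * (1 / real m) \<le> (k * n powr (3/5)) * (2 * k / n)"
    by (intro mult_left_mono) auto
  also have "\<dots> = 2 * (real k)\<^sup>2 * n powr (3/5) / n"
    by (simp add: power2_eq_square)
  also have "\<dots> \<le> 2 * K\<^sup>2 * n powr (3/5) / n"
    using kK by (intro divide_right_mono mult_right_mono) auto
  finally have T: "k * n powr (3/5) / m \<le> 2 * K\<^sup>2 * n powr (3/5) / n"
    by simp
  define B1 where "B1 = {f. \<not> (\<exists>A\<subseteq>{..<n}. card A = k \<and> (\<forall>v\<in>{..<n} - A. \<exists>a\<in>A. f {v, a}))}"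
  define B2 where "B2 = {f. \<exists>c::nat \<Rightarrow> nat. c \<in> {..<n} \<rightarrow> {..<k - 4} \<and> conflict_free (coin_graph n f) c}"
  define Good where "Good = {f. int (domination_number (coin_graph n f)) - 3
    \<le> int (cf_chromatic_number (coin_graph n f))}"
  have "?P B1 \<le> exp (k * n powr (3/5) / (n div k)) / (1 - 2 * k * q ^ k) - 1"
    unfolding B1_def q_def
    by (rule prob_not_dominated_le[OF p k(1) kn k(3)[unfolded q_def] Q1[unfolded q_def]])
  also have "\<dots> \<le> exp (2 * K\<^sup>2 * n powr (3/5) / n) / (1 - K\<^sup>2 * ln n / n) - 1"
    using T Q K(2) by (intro diff_right_mono frac_le) (auto simp: m_def)
  finally have B1: "?P B1 \<le> exp (2 * K\<^sup>2 * n powr (3/5) / n) / (1 - K\<^sup>2 * ln n / n) - 1" .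
  have "?P B2 \<le> real ((n + 1) ^ (3 * (k - 4))) * (1 - q ^ (k - 4)) ^ (n - 3 * (k - 4))"
    unfolding B2_def q_def by (rule prob_conflict_free_le[OF p])
  also have "\<dots> \<le> 1 / n"
    by (rule coloring_count_bound[OF q n(3) k(1,4)])
  finally have B2: "?P B2 \<le> 1 / n" .
  have "f \<in> Good" if "f \<notin> B1" "f \<notin> B2" for f
  proof -
    \<comment> \<open>Failure of \<open>k - 4\<close> colors forces at least \<open>k - 3\<close>,
      which is where the 3 in the statement comes from.\<close>
    have "domination_number (coin_graph n f) \<le> k"
      using domination_number_coin_graph_le that(1) unfolding B1_def by blast
    moreover have "k - 4 < cf_chromatic_number (coin_graph n f)"
      using cf_chromatic_number_coin_graph_gt that(2) unfolding B2_def by blast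
    ultimately show ?thesis
      unfolding Good_def by simp
  qed
  then have "UNIV - Good \<subseteq> B1 \<union> B2"
    by blast
  then have "?P (UNIV - Good) \<le> ?P (B1 \<union> B2)"
    by (rule measure_pmf.finite_measure_mono) simp
  also have "\<dots> \<le> ?P B1 + ?P B2"
    by (rule measure_Un_le) simp_all
  finally have "1 - ?P Good \<le> failure_bound n"
    using B1 B2 measure_pmf.prob_compl[of Good "coins n p"]
    by (simp add: failure_bound_def K_def)
  then show ?thesis
    unfolding prob_erdos_renyi Good_def by simp
qed

theorem theorem2:
  shows "(\<forall>G :: 'a ugraph. finite_simple_graph G \<longrightarrow>
            cf_chromatic_number G \<le> domination_number G + 1) \<and>
         (\<forall>p :: nat \<Rightarrow> real. (\<forall>n. 1 / 2 \<le> p n \<and> p n \<le> 1) \<longrightarrow>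
            (\<lambda>n. measure_pmf.prob (erdos_renyi n (p n))
                   {G. int (domination_number G) - 3 \<le> int (cf_chromatic_number G)})
              \<longlonglongrightarrow> 1)"
proof (intro conjI allI impI)
  show "cf_chromatic_number G \<le> domination_number G + 1"
    if "finite_simple_graph G" for G :: "'a ugraph"
    using that by (rule cf_chromatic_number_le_domination_number)
next
  fix p :: "nat \<Rightarrow> real"
  assume p: "\<forall>n. 1 / 2 \<le> p n \<and> p n \<le> 1"
  show "(\<lambda>n. measure_pmf.prob (erdos_renyi n (p n))
      {G. int (domination_number G) - 3 \<le> int (cf_chromatic_number G)}) \<longlonglongrightarrow> 1"
  \<comment> \<open>The lower bound \<open>1 - failure_bound n\<close> does not involve
    \<open>p n\<close>; the upper bound is that a probability is at most 1.\<close>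
  proof (rule tendsto_sandwich[where h = "\<lambda>_. 1"])
    show "\<forall>\<^sub>F n in sequentially. 1 - failure_bound n \<le> measure_pmf.prob (erdos_renyi n (p n))
        {G. int (domination_number G) - 3 \<le> int (cf_chromatic_number G)}"
      using eventually_large_enough
    proof eventually_elim
      case (elim n)
      then show ?case
        using p by (intro prob_lower_bound_ge) auto
    qed
    show "(\<lambda>n. 1 - failure_bound n) \<longlonglongrightarrow> 1"
      using tendsto_diff[OF tendsto_const failure_bound_tendsto_0, of 1] by simp
  qed simp_all
qed

end
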